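(* Let $\mathcal{R}=\{(r,t)\mid r>0,\ t\in\mathbb{R}\}$ be equipped with the Riemannian metric $ds_1^2=dr^2+r^2\,dt^2$. Then $(\mathcal{R},ds_1^2)$ is not geodesically complete.
   Context: A Riemannian manifold is geodesically complete if every geodesic extends to a geodesic defined on all of $\mathbb{R}$. *)

theory Defs
  imports "HOL-Analysis.Analysis"
begin

text \<open>
  Riemannian geometry on an open subset \<open>M\<close> of \<open>\<real>\<^sup>n\<close>, viewed as a manifold with a single
  global chart.  A metric is given by its coefficient matrix: \<open>g x $ i $ j\<close> is \<open>g\<^sub>i\<^sub>j(x)\<close>.
\<close>

text \<open>Intended for open \<open>S\<close> in a finite-dimensional space.\<close>

primrec Ck_on ::
  "nat \<Rightarrow> 'a::real_normed_vector set \<Rightarrow> ('a \<Rightarrow> 'b::real_normed_vector) \<Rightarrow> bool" where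
  "Ck_on 0 S f \<longleftrightarrow> continuous_on S f"
| "Ck_on (Suc k) S f \<longleftrightarrow>
     (\<forall>x\<in>S. f differentiable at x) \<and>
     (\<forall>v. Ck_on k S (\<lambda>x. frechet_derivative f (at x) v))"

definition smooth_on ::
  "'a::real_normed_vector set \<Rightarrow> ('a \<Rightarrow> 'b::real_normed_vector) \<Rightarrow> bool" where
  "smooth_on S f \<longleftrightarrow> (\<forall>k. Ck_on k S f)"

definition riemannian_metric_on :: "(real^'n) set \<Rightarrow> (real^'n \<Rightarrow> real^'n^'n) \<Rightarrow> bool" where
  "riemannian_metric_on M g \<longleftrightarrow>
     open M \<and> smooth_on M g \<and>
     (\<forall>x\<in>M. transpose (g x) = g x \<and> (\<forall>v. v \<noteq> 0 \<longrightarrow> v \<bullet> (g x *v v) > 0))"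

definition partial_deriv :: "'n \<Rightarrow> (real^'n \<Rightarrow> real) \<Rightarrow> real^'n \<Rightarrow> real" where
  "partial_deriv i f x = frechet_derivative f (at x) (axis i 1)"

text \<open>\<open>christoffel g k i j x\<close> is \<open>\<Gamma>\<^sup>k\<^sub>i\<^sub>j(x)\<close> for the Levi-Civita connection of \<open>g\<close>.\<close>

definition christoffel ::
  "(real^'n \<Rightarrow> real^'n^'n) \<Rightarrow> 'n \<Rightarrow> 'n \<Rightarrow> 'n \<Rightarrow> real^'n \<Rightarrow> real" where
  "christoffel g k i j x =
     (1/2) * (\<Sum>l\<in>UNIV. matrix_inv (g x) $ k $ l *
       (partial_deriv i (\<lambda>y. g y $ j $ l) x
        + partial_deriv j (\<lambda>y. g y $ i $ l) x
        - partial_deriv l (\<lambda>y. g y $ i $ j) x))"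

text \<open>The \<open>k\<close>-th component of the covariant acceleration \<open>\<nabla>\<^bsub>c'\<^esub> c'\<close> of the curve \<open>c\<close> at time \<open>s\<close>.\<close>

definition covariant_acceleration ::
  "(real^'n \<Rightarrow> real^'n^'n) \<Rightarrow> (real \<Rightarrow> real^'n) \<Rightarrow> real \<Rightarrow> 'n \<Rightarrow> real" where
  "covariant_acceleration g c s k =
     vector_derivative (\<lambda>u. vector_derivative c (at u)) (at s) $ k
     + (\<Sum>i\<in>UNIV. \<Sum>j\<in>UNIV. christoffel g k i j (c s)
          * vector_derivative c (at s) $ i * vector_derivative c (at s) $ j)"

text \<open>
  Geodesics are affinely parametrised and defined on nonempty open intervals, which may be
  unbounded; values of \<open>c\<close> outside \<open>I\<close> are irrelevant.
\<close>

definition geodesic_on ::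
  "(real^'n) set \<Rightarrow> (real^'n \<Rightarrow> real^'n^'n) \<Rightarrow> real set \<Rightarrow> (real \<Rightarrow> real^'n) \<Rightarrow> bool" where
  "geodesic_on M g I c \<longleftrightarrow>
     open I \<and> is_interval I \<and> I \<noteq> {} \<and> smooth_on I c \<and> c ` I \<subseteq> M \<and>
     (\<forall>s\<in>I. \<forall>k. covariant_acceleration g c s k = 0)"

definition geodesically_complete :: "(real^'n) set \<Rightarrow> (real^'n \<Rightarrow> real^'n^'n) \<Rightarrow> bool" where
  "geodesically_complete M g \<longleftrightarrow>
     (\<forall>I c. geodesic_on M g I c \<longrightarrow>
        (\<exists>c'. geodesic_on M g UNIV c' \<and> (\<forall>s\<in>I. c' s = c s)))"

text \<open>The point \<open>(r, t)\<close> is the vector \<open>x\<close> with \<open>x $ 1 = r\<close> and \<open>x $ 2 = t\<close>.\<close>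

definition polar_halfplane :: "(real^2) set" where
  "polar_halfplane = {x. x $ 1 > 0}"

definition polar_metric :: "real^2 \<Rightarrow> real^2^2" where
  "polar_metric x = vector [vector [1, 0], vector [0, (x $ 1)\<^sup>2]]"

lemma polar_metric_quadratic_form:
  "v \<bullet> (polar_metric x *v v) = (v $ 1)\<^sup>2 + (x $ 1)\<^sup>2 * (v $ 2)\<^sup>2"
  by (simp add: polar_metric_def inner_vec_def matrix_vector_mult_def sum_2
      power2_eq_square algebra_simps)

lemma smooth_on_polar_metric: "smooth_on S polar_metric"
proof -
  define E :: "real^2^2" where "E = vector [0, vector [0, 1]]"
  define C :: "real^2^2" where "C = vector [vector [1, 0], 0]"
  have const: "Ck_on k S (\<lambda>x::real^2. A)" for k and A :: "real^2^2"
    by (induction k arbitrary: A) (simp_all add: frechet_derivative_const)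
  have lin_d: "((\<lambda>x::real^2. (a * x $ 1) *\<^sub>R E) has_derivative (\<lambda>v. (a * v $ 1) *\<^sub>R E)) (at x)"
    for a x
    by (auto intro!: derivative_eq_intros bounded_linear_imp_has_derivative[OF bounded_linear_vec_nth])
  have lin: "Ck_on k S (\<lambda>x::real^2. (a * x $ 1) *\<^sub>R E)" for k a
  proof (cases k)
    case 0
    then show ?thesis by (auto intro!: continuous_intros)
  next
    case (Suc m)
    then show ?thesis
      using lin_d const by (auto simp: frechet_derivative_at[OF lin_d, symmetric] differentiable_def)
  qed
  have eq: "polar_metric = (\<lambda>x. C + (x $ 1)\<^sup>2 *\<^sub>R E)"
    by (auto simp: fun_eq_iff polar_metric_def C_def E_def vec_eq_iff forall_2)
  have d: "(polar_metric has_derivative (\<lambda>v. ((2 * v $ 1) * x $ 1) *\<^sub>R E)) (at x)" for x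
    unfolding eq by (auto intro!: derivative_eq_intros bounded_linear_imp_has_derivative[OF bounded_linear_vec_nth] simp: algebra_simps)
  have "Ck_on k S polar_metric" for k
  proof (cases k)
    case 0
    have "continuous_on S polar_metric"
      unfolding eq by (intro continuous_intros)
    with 0 show ?thesis by simp
  next
    case (Suc m)
    then show ?thesis
      using d lin by (auto simp: frechet_derivative_at[OF d, symmetric] differentiable_def)
  qed
  then show ?thesis by (simp add: smooth_on_def)
qed

lemma riemannian_metric_on_polar: "riemannian_metric_on polar_halfplane polar_metric"
proof -
  have "open polar_halfplane"
    unfolding polar_halfplane_def by (intro open_Collect_less continuous_intros)
  moreover have "transpose (polar_metric x) = polar_metric x" for x
    by (simp add: polar_metric_def transpose_def vec_eq_iff forall_2)
  moreover have "v \<bullet> (polar_metric x *v v) > 0" if "x \<in> polar_halfplane" "v \<noteq> 0" for x v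
  proof (cases "v $ 1 = 0")
    case True
    with that have "v $ 2 \<noteq> 0" by (auto simp: vec_eq_iff forall_2)
    with that show ?thesis
      by (simp add: polar_metric_quadratic_form polar_halfplane_def add_nonneg_pos)
  next
    case False
    then show ?thesis
      by (simp add: polar_metric_quadratic_form add_pos_nonneg)
  qed
  ultimately show ?thesis
    by (simp add: riemannian_metric_on_def smooth_on_polar_metric)
qed

end

theory Submission
  imports Defs
begin

text \<open>
  The half-plane with its polar metric is missing the pole \<open>r = 0\<close>.  The ray
  \<open>s \<mapsto> (s, 0)\<close>, \<open>s > 0\<close>, is a geodesic that runs into the pole in finite time: its
  coordinate acceleration vanishes, and its velocity sees only the Christoffel symbols
  \<open>\<Gamma>\<^sup>k\<^sub>1\<^sub>1\<close>, which vanish because the first row \<open>(1, 0)\<close> of the metric is constant.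

  A geodesic on all of \<open>\<real>\<close> that agrees with the ray for \<open>s > 0\<close> would in particular be a
  continuous curve, so its value at \<open>s = 0\<close> would be the limit of the ray, whose radius
  is \<open>0\<close>; this point is not in the half-plane.
\<close>

lemma Ck_on_const: "Ck_on k S (\<lambda>x. a)"
  by (induction k arbitrary: a) (simp_all add: frechet_derivative_const)

text \<open>A bounded linear map is its own derivative at every point, so its directional
  derivatives are constant.\<close>

lemma smooth_on_bounded_linear:
  assumes "bounded_linear f"
  shows "smooth_on S f"
proof -
  have d: "(f has_derivative f) (at x)" for x
    using assms by (rule bounded_linear_imp_has_derivative)
  have "Ck_on k S f" for k
  proof (cases k)
    case 0
    then show ?thesis
      using assms by (simp add: linear_continuous_on)
  next
    case (Suc m)
    then show ?thesis
      using d by (auto simp: frechet_derivative_at[OF d, symmetric] differentiable_def Ck_on_const)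
  qed
  then show ?thesis
    by (simp add: smooth_on_def)
qed

text \<open>In \<open>\<Gamma>\<^sup>k\<^sub>i\<^sub>i\<close> only derivatives of entries of the \<open>i\<close>-th row of the metric occur.\<close>

lemma christoffel_eq_0_if_row_const:
  assumes "\<And>x. g x $ i = a"
  shows "christoffel g k i i x = 0"
  by (simp add: christoffel_def partial_deriv_def assms frechet_derivative_const)

lemma vector_derivative_line:
  "vector_derivative (\<lambda>s. s *\<^sub>R v) (at s) = v"
  by (rule vector_derivative_at) (auto intro!: derivative_eq_intros)

lemma covariant_acceleration_coordinate_line:
  assumes "\<And>x. g x $ i = a"
  shows "covariant_acceleration g (\<lambda>s. s *\<^sub>R axis i 1) s k = 0"
proof -
  have "christoffel g k p q x * axis i 1 $ p * axis i 1 $ q = 0" for p q x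
    using christoffel_eq_0_if_row_const[of g i a k x, OF assms] by (simp add: axis_def)
  then show ?thesis
    unfolding covariant_acceleration_def vector_derivative_line
    by (simp only: vector_derivative_const_at sum.neutral_const zero_index add_0)
qed

lemma geodesic_on_polar_ray:
  "geodesic_on polar_halfplane polar_metric {0<..} (\<lambda>s. s *\<^sub>R axis 1 1)"
proof -
  have row: "polar_metric x $ 1 = vector [1, 0]" for x
    by (simp add: polar_metric_def)
  have "smooth_on {0<..} (\<lambda>s. s *\<^sub>R axis 1 1 :: real^2)"
    by (rule smooth_on_bounded_linear) (rule bounded_linear_scaleR_left)
  then show ?thesis
    by (auto simp: geodesic_on_def polar_halfplane_def
        covariant_acceleration_coordinate_line[OF row])
qed

lemma geodesic_on_continuous_on:
  assumes "geodesic_on M g I c"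
  shows "continuous_on I c"
proof -
  have "Ck_on 0 I c"
    using assms unfolding geodesic_on_def smooth_on_def by blast
  then show ?thesis
    by simp
qed

theorem corollary3p3:
  "\<not> geodesically_complete polar_halfplane polar_metric"
proof
  assume "geodesically_complete polar_halfplane polar_metric"
  then obtain c where c: "geodesic_on polar_halfplane polar_metric UNIV c"
    and ext: "\<forall>s\<in>{0<..}. c s = s *\<^sub>R axis 1 1"
    using geodesic_on_polar_ray unfolding geodesically_complete_def by blast
  have "isCont c 0"
    using geodesic_on_continuous_on[OF c] by (simp add: continuous_on_eq_continuous_at)
  then have "(c \<longlongrightarrow> c 0) (at_right 0)"
    by (simp add: isCont_def filterlim_at_split)
  then have "((\<lambda>s. c s $ 1) \<longlongrightarrow> c 0 $ 1) (at_right 0)"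
    by (rule tendsto_vec_nth)
  moreover have "\<forall>\<^sub>F s in at_right 0. c s $ 1 = s"
    using eventually_at_right_less[of "0::real"] by eventually_elim (simp add: ext)
  ultimately have "((\<lambda>s. s) \<longlongrightarrow> c 0 $ 1) (at_right 0)"
    by (rule Lim_transform_eventually)
  then have "c 0 $ 1 = 0"
    by (rule tendsto_unique[OF trivial_limit_at_right_real _ tendsto_ident_at])
  moreover have "c 0 \<in> polar_halfplane"
    using c by (auto simp: geodesic_on_def)
  ultimately show False
    by (simp add: polar_halfplane_def)
qed

end
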